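(* Let $d\ge1$, $T=(T_1,\dots,T_d)$ with $T_i>0$, and $[0,T]=\prod_{i=1}^d[0,T_i]$. Let $\{Z_k:k\in\mathbb{N}^d\}$ be independent and identically distributed centered random variables with unit variance, and let $\{\theta_n\}_{n\in\mathbb{N}}$ be the Donsker kernels $$\theta_n(t)=n^{\frac d2}\sum_{k\in\mathbb{N}^d}Z_k\,\mathbb{I}_{[k-1,k)}(nt),\qquad t\in[0,T].$$ Then, for any even integer $m\in\mathbb{N}$, if the random variables $Z_k$ have finite moments of order $m$, there is a positive constant $C$, independent of $n$ and of $\{g_n\}_{n\in\mathbb{N}}$, such that for any sequence of functions $\{g_n\}_{n\in\mathbb{N}}\subset L^2([0,T])$ and every $n\in\mathbb{N}$, $$\mathbb{E}\left[\left(\int_{[0,T]}g_n(u)\theta_n(u)\,du\right)^m\right]\le C\left(\int_{[0,T]}g_n^2(u)\,du\right)^{\frac m2}.$$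
   Context: $\mathbb{N}=\{1,2,\dots\}$. For $k=(k_1,\dots,k_d)\in\mathbb{N}^d$, $k-1=(k_1-1,\dots,k_d-1)$ and $[k-1,k)=\prod_{i=1}^d[k_i-1,k_i)$. $\mathbb{I}_A$ denotes the indicator function of $A\subset\mathbb{R}^d$. *)

theory Defs
  imports "HOL-Probability.Probability"
begin

text \<open>Here the natural numbers start at 1, so the multi-indices
  exclude vectors with a zero entry. The dimension is \<open>CARD('d)\<close>.\<close>

definition pos_multi :: "(nat ^ 'd::finite) set" where
  "pos_multi = {k. \<forall>i. 1 \<le> k $ i}"

definition unit_cell :: "nat ^ 'd::finite \<Rightarrow> (real ^ 'd) set" where
  "unit_cell k = {x. \<forall>i. real (k $ i) - 1 \<le> x $ i \<and> x $ i < real (k $ i)}"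

text \<open>The cells are pairwise disjoint, so at most one term of the sum is nonzero and
  the unordered infinite sum is the intended one.\<close>

definition donsker_kernel ::
  "(nat ^ 'd::finite \<Rightarrow> 'w \<Rightarrow> real) \<Rightarrow> nat \<Rightarrow> real ^ 'd \<Rightarrow> 'w \<Rightarrow> real" where
  "donsker_kernel Z n t \<omega> =
     real n powr (real CARD('d) / 2) *
     (\<Sum>\<^sub>\<infinity>k\<in>pos_multi. Z k \<omega> * indicator (unit_cell k) (real n *\<^sub>R t))"

text \<open>Membership in \<open>L\<^sup>2(S)\<close> for a function (not an equivalence class) with respect to
  Lebesgue measure; values outside \<open>S\<close> are irrelevant.\<close>

definition square_integrable_on :: "('a::euclidean_space \<Rightarrow> real) \<Rightarrow> 'a set \<Rightarrow> bool" where
  "square_integrable_on f S \<longleftrightarrow>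
     f \<in> borel_measurable (lebesgue_on S) \<and> integrable (lebesgue_on S) (\<lambda>u. (f u)\<^sup>2)"

end

theory Submission
  imports Defs
begin

text \<open>Since the cells are disjoint, the integral of \<open>g\<^sub>n \<theta>\<^sub>n\<close> is a finite weighted sum
  \<open>\<Sum>\<^sub>k b\<^sub>k Z\<^sub>k\<close>, and by Cauchy--Schwarz on cells of volume \<open>n\<^sup>-\<^sup>d\<close> the weights satisfy
  \<open>\<Sum>\<^sub>k b\<^sub>k\<^sup>2 \<le> \<integral> g\<^sub>n\<^sup>2\<close>. It remains to bound the moment of order \<open>2p\<close> of a sum \<open>S\<close> of independent
  centred variables by a constant times \<open>(\<Sum>\<^sub>k b\<^sub>k\<^sup>2)\<^sup>p\<close>. When a further summand \<open>X\<close> is added, the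
  binomial expansion gives
  \<open>(X + S)\<^sup>2\<^sup>p \<le> S\<^sup>2\<^sup>p + 2p X S\<^sup>2\<^sup>p\<^sup>-\<^sup>1 + 4\<^sup>p (X\<^sup>2 S\<^sup>2\<^sup>p\<^sup>-\<^sup>2 + X\<^sup>2\<^sup>p)\<close>, where the linear term has mean zero and
  the mixed term factorizes; induction on \<open>p\<close> and on the number of summands closes the argument.\<close>

section \<open>Even moments of sums of independent centred variables\<close>

text \<open>Every binomial term of index at least 2 contains \<open>x\<^sup>2\<close>, and the
  remaining degree \<open>n\<close> is absorbed by \<open>x ^ n + s ^ n\<close>, both summands being
  nonnegative because \<open>n\<close> is even. The binomial coefficients together contribute at
  most \<open>2 ^ Suc (Suc n)\<close>.\<close>

lemma power_add_le_second_order: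
  fixes x s :: real
  assumes "even n"
  shows "(x + s) ^ Suc (Suc n) \<le>
    s ^ Suc (Suc n) + real (Suc (Suc n)) * (x * s ^ Suc n) +
    2 ^ Suc (Suc n) * (x\<^sup>2 * s ^ n + x ^ Suc (Suc n))"
proof -
  let ?N = "Suc (Suc n)"
  let ?R = "x\<^sup>2 * s ^ n + x ^ ?N"
  have R: "x ^ (k + 2) * s ^ (n - k) \<le> ?R" if "k \<le> n" for k
  proof -
    \<comment> \<open>With both factors replaced by the larger modulus, the product becomes
      \<open>y ^ n\<close>, which is one of the two even powers on the right.\<close>
    define y where "y = max \<bar>x\<bar> \<bar>s\<bar>"
    have "\<bar>x\<bar> ^ k * \<bar>s\<bar> ^ (n - k) \<le> y ^ k * y ^ (n - k)"
      by (intro mult_mono power_mono) (auto simp: y_def)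
    also have "\<dots> = y ^ n"
      using that by (simp flip: power_add)
    also have "\<dots> \<le> x ^ n + s ^ n"
      using assms by (auto simp: y_def max_def power_even_abs)
    finally have "\<bar>x\<bar> ^ k * \<bar>s\<bar> ^ (n - k) \<le> x ^ n + s ^ n" .
    then have "x\<^sup>2 * (\<bar>x\<bar> ^ k * \<bar>s\<bar> ^ (n - k)) \<le> x\<^sup>2 * (x ^ n + s ^ n)"
      by (intro mult_left_mono) auto
    moreover have "x ^ (k + 2) * s ^ (n - k) \<le> \<bar>x ^ (k + 2) * s ^ (n - k)\<bar>"
      by simp
    moreover have "\<bar>x ^ (k + 2) * s ^ (n - k)\<bar> = x\<^sup>2 * (\<bar>x\<bar> ^ k * \<bar>s\<bar> ^ (n - k))"
      by (simp add: abs_mult power_abs power2_eq_square)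
    ultimately show ?thesis
      by (simp add: algebra_simps power2_eq_square)
  qed
  have R0: "0 \<le> ?R"
    using assms by (intro add_nonneg_nonneg mult_nonneg_nonneg zero_le_even_power) auto
  have choose_le: "(\<Sum>k\<le>n. real (?N choose (k + 2))) \<le> 2 ^ ?N"
  proof -
    have "(\<Sum>k\<le>n. ?N choose (k + 2)) \<le> (\<Sum>k\<le>?N. ?N choose k)"
      unfolding sum.atMost_Suc_shift[of _ "Suc n"] sum.atMost_Suc_shift[of _ n] by simp
    also have "\<dots> = 2 ^ ?N"
      by (rule choose_row_sum)
    finally show ?thesis
      by (metis of_nat_le_iff of_nat_numeral of_nat_power of_nat_sum)
  qed
  have "(x + s) ^ ?N = (\<Sum>k\<le>?N. real (?N choose k) * x ^ k * s ^ (?N - k))"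
    by (rule binomial_ring)
  also have "\<dots> = s ^ ?N + real ?N * (x * s ^ Suc n) +
      (\<Sum>k\<le>n. real (?N choose (k + 2)) * (x ^ (k + 2) * s ^ (n - k)))"
    \<comment> \<open>The two shifts split off the indices 0 and 1, that is, the constant and linear
      terms in \<open>x\<close>.\<close>
    unfolding sum.atMost_Suc_shift[of _ "Suc n"] sum.atMost_Suc_shift[of _ n]
    by (simp add: mult.assoc del: binomial_Suc_Suc)
  also have "(\<Sum>k\<le>n. real (?N choose (k + 2)) * (x ^ (k + 2) * s ^ (n - k))) \<le>
      (\<Sum>k\<le>n. real (?N choose (k + 2)) * ?R)"
    using R by (intro sum_mono mult_left_mono) auto
  also have "\<dots> = (\<Sum>k\<le>n. real (?N choose (k + 2))) * ?R"
    by (rule sum_distrib_right[symmetric])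
  also have "\<dots> \<le> 2 ^ ?N * ?R"
    by (rule mult_right_mono[OF choose_le R0])
  finally show ?thesis by simp
qed

lemma abs_power_le_1_plus_power:
  fixes x :: real
  assumes "k \<le> n"
  shows "\<bar>x\<bar> ^ k \<le> 1 + \<bar>x\<bar> ^ n"
proof (cases "\<bar>x\<bar> \<le> 1")
  case True
  then have "\<bar>x\<bar> ^ k \<le> 1" by (simp add: power_le_one)
  then show ?thesis by (simp add: add_increasing2)
next
  case False
  then have "\<bar>x\<bar> ^ k \<le> \<bar>x\<bar> ^ n"
    using assms by (intro power_increasing) auto
  then show ?thesis by simp
qed

text \<open>Constants are integrable on a finite measure space, so \<open>1 + f x ^ n\<close>
  dominates all lower powers. This serves both the moments of random variables and, with
  \<open>n = 2\<close> and \<open>k = 1\<close>, the inclusion of L2 in L1 on the box.\<close>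

lemma (in finite_measure) integrable_power_le:
  fixes f :: "'a \<Rightarrow> real"
  assumes [measurable]: "f \<in> borel_measurable M"
    and "integrable M (\<lambda>x. f x ^ n)" "even n" "k \<le> n"
  shows "integrable M (\<lambda>x. f x ^ k)"
proof (rule Bochner_Integration.integrable_bound)
  show "integrable M (\<lambda>x. 1 + f x ^ n)"
    using assms by simp
  show "AE x in M. norm (f x ^ k) \<le> norm (1 + f x ^ n)"
  proof (rule AE_I2)
    fix x
    show "norm (f x ^ k) \<le> norm (1 + f x ^ n)"
      using abs_power_le_1_plus_power[OF \<open>k \<le> n\<close>, of "f x"] \<open>even n\<close>
      by (simp add: power_abs power_even_abs)
  qed
qed simp

text \<open>The recursion is read off from the induction step: the power of 2 comes from the
  second-order bound, the product \<open>\<mu> * moment_const \<mu> p\<close> from the mixed term,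
  and the last \<open>\<mu>\<close> from the pure power of the new summand.\<close>

primrec moment_const :: "real \<Rightarrow> nat \<Rightarrow> real" where
  "moment_const \<mu> 0 = 1"
| "moment_const \<mu> (Suc p) = 2 ^ (2 * Suc p) * (\<mu> * moment_const \<mu> p + \<mu>)"

lemma moment_const_pos: "0 < \<mu> \<Longrightarrow> 0 < moment_const \<mu> p"
  by (induction p) (auto intro!: mult_pos_pos add_pos_pos)

text \<open>The increment of the power \<open>Suc p\<close> between \<open>B\<close> and
  \<open>B + v\<close> dominates both error terms of the moment induction, which is why the constant
  does not grow with the number of summands.\<close>

lemma add_power_ge:
  fixes B v :: real
  assumes "0 \<le> B" "0 \<le> v"
  shows "B ^ Suc p + v * B ^ p \<le> (B + v) ^ Suc p"
    and "B ^ Suc p + v ^ Suc p \<le> (B + v) ^ Suc p"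
proof -
  have "(B + v) * B ^ p \<le> (B + v) * (B + v) ^ p"
    using assms by (intro mult_left_mono power_mono) auto
  then show "B ^ Suc p + v * B ^ p \<le> (B + v) ^ Suc p"
    by (simp add: algebra_simps)
  have "B * B ^ p + v * v ^ p \<le> B * (B + v) ^ p + v * (B + v) ^ p"
    using assms by (intro add_mono mult_left_mono power_mono) auto
  then show "B ^ Suc p + v ^ Suc p \<le> (B + v) ^ Suc p"
    by (simp add: algebra_simps)
qed

text \<open>Here \<open>v i\<close> is a variance scale: the moment hypothesis has the form
  satisfied by \<open>b * Z\<close> with \<open>v = b\<^sup>2\<close>. The set \<open>J\<close> is
  generalized in the induction on \<open>p\<close> because the mixed term calls for the lower order
  on the sum without the new index.\<close>

lemma (in prob_space) even_moment_sum_indep_le: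
  fixes X :: "'i \<Rightarrow> 'a \<Rightarrow> real"
  assumes "finite J" "indep_vars (\<lambda>_. borel) X J" "0 < \<mu>"
    and "\<And>i. i \<in> J \<Longrightarrow> 0 \<le> v i"
    and "\<And>i. i \<in> J \<Longrightarrow> integrable M (\<lambda>\<omega>. X i \<omega> ^ (2 * p))"
    and "\<And>i. i \<in> J \<Longrightarrow> expectation (X i) = 0"
    and "\<And>i q. i \<in> J \<Longrightarrow> q \<le> p \<Longrightarrow> expectation (\<lambda>\<omega>. X i \<omega> ^ (2 * q)) \<le> \<mu> * v i ^ q"
  shows "integrable M (\<lambda>\<omega>. (\<Sum>i\<in>J. X i \<omega>) ^ (2 * p)) \<and>
    expectation (\<lambda>\<omega>. (\<Sum>i\<in>J. X i \<omega>) ^ (2 * p)) \<le> moment_const \<mu> p * (\<Sum>i\<in>J. v i) ^ p"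
  using assms
proof (induction p arbitrary: J)
  case 0
  then show ?case by (simp add: prob_space)
next
  case (Suc p)
  show ?case
    using Suc.prems
  proof (induction J rule: finite_induct)
    case empty
    then show ?case by simp
  next
    case (insert j J)
    let ?S = "\<lambda>\<omega>. \<Sum>i\<in>J. X i \<omega>"
    let ?n = "2 * p"
    let ?B = "\<Sum>i\<in>J. v i"
    have indJ: "indep_vars (\<lambda>_. borel) X J"
      by (rule indep_vars_subset[OF insert.prems(1)]) auto
    have rv: "random_variable borel (X i)" if "i \<in> insert j J" for i
      using insert.prems(1) that by (auto simp: indep_vars_def)
    have [measurable]: "random_variable borel (X j)" using rv by simp
    have [measurable]: "random_variable borel ?S"
      using rv by (intro borel_measurable_sum) auto
    have intX: "integrable M (\<lambda>\<omega>. X i \<omega> ^ k)" if "i \<in> insert j J" "k \<le> 2 * Suc p" for i k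
      by (rule integrable_power_le[OF rv insert.prems(4)]) (use that in simp_all)
    have IHJ: "integrable M (\<lambda>\<omega>. ?S \<omega> ^ (2 * Suc p))"
        "expectation (\<lambda>\<omega>. ?S \<omega> ^ (2 * Suc p)) \<le> moment_const \<mu> (Suc p) * ?B ^ Suc p"
      using insert.IH[OF indJ] insert.prems by simp_all
    \<comment> \<open>The outer induction hypothesis, applied to the sum without \<open>j\<close>;
      it controls the mixed term.\<close>
    have IHp: "expectation (\<lambda>\<omega>. ?S \<omega> ^ ?n) \<le> moment_const \<mu> p * ?B ^ p"
      using Suc.IH[OF insert.hyps(1) indJ] insert.prems intX by simp
    have intS: "integrable M (\<lambda>\<omega>. ?S \<omega> ^ k)" if "k \<le> 2 * Suc p" for k
      by (rule integrable_power_le[OF _ IHJ(1)]) (use that in simp_all)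
    have ind: "indep_var borel (X j) borel ?S"
      by (rule indep_vars_sum[OF insert.hyps insert.prems(1)])
    have prod: "integrable M (\<lambda>\<omega>. X j \<omega> ^ k * ?S \<omega> ^ l)"
      "expectation (\<lambda>\<omega>. X j \<omega> ^ k * ?S \<omega> ^ l) =
        expectation (\<lambda>\<omega>. X j \<omega> ^ k) * expectation (\<lambda>\<omega>. ?S \<omega> ^ l)"
      if "k \<le> 2 * Suc p" "l \<le> 2 * Suc p" for k l
    proof -
      have "indep_var borel ((\<lambda>x. x ^ k) \<circ> X j) borel ((\<lambda>x. x ^ l) \<circ> ?S)"
        by (rule indep_var_compose[OF ind]) auto
      then have i: "indep_var borel (\<lambda>\<omega>. X j \<omega> ^ k) borel (\<lambda>\<omega>. ?S \<omega> ^ l)"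
        by (simp add: comp_def)
      show "integrable M (\<lambda>\<omega>. X j \<omega> ^ k * ?S \<omega> ^ l)"
        by (rule indep_var_integrable[OF i intX intS]) (use that in auto)
      show "expectation (\<lambda>\<omega>. X j \<omega> ^ k * ?S \<omega> ^ l) =
        expectation (\<lambda>\<omega>. X j \<omega> ^ k) * expectation (\<lambda>\<omega>. ?S \<omega> ^ l)"
        by (rule indep_var_lebesgue_integral[OF i intX intS]) (use that in auto)
    qed
    have eq: "(\<Sum>i\<in>insert j J. X i \<omega>) = X j \<omega> + ?S \<omega>" for \<omega>
      using insert.hyps by simp
    have eqB: "(\<Sum>i\<in>insert j J. v i) = ?B + v j"
      using insert.hyps by simp
    have B0: "0 \<le> ?B" "0 \<le> v j"
      using insert.prems by (auto intro!: sum_nonneg)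
    \<comment> \<open>The exponent 1 is kept explicit so that the linear term is an instance of
      \<open>prod\<close>.\<close>
    define U where "U = (\<lambda>\<omega>. ?S \<omega> ^ (2 * Suc p) + real (2 * Suc p) * (X j \<omega> ^ 1 * ?S \<omega> ^ Suc ?n)
      + 2 ^ (2 * Suc p) * (X j \<omega> ^ 2 * ?S \<omega> ^ ?n + X j \<omega> ^ (2 * Suc p)))"
    have intU: "integrable M U"
      unfolding U_def
      by (intro Bochner_Integration.integrable_add integrable_mult_right prod intX intS) auto
    have le: "(X j \<omega> + ?S \<omega>) ^ (2 * Suc p) \<le> U \<omega>" for \<omega>
      using power_add_le_second_order[of ?n "X j \<omega>" "?S \<omega>"] by (simp add: U_def)
    have int: "integrable M (\<lambda>\<omega>. (X j \<omega> + ?S \<omega>) ^ (2 * Suc p))"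
    proof (rule Bochner_Integration.integrable_bound[OF intU])
      show "AE \<omega> in M. norm ((X j \<omega> + ?S \<omega>) ^ (2 * Suc p)) \<le> norm (U \<omega>)"
      proof (rule AE_I2)
        fix \<omega>
        have "norm ((X j \<omega> + ?S \<omega>) ^ (2 * Suc p)) = (X j \<omega> + ?S \<omega>) ^ (2 * Suc p)"
          unfolding real_norm_def by (intro abs_of_nonneg zero_le_even_power) simp
        then show "norm ((X j \<omega> + ?S \<omega>) ^ (2 * Suc p)) \<le> norm (U \<omega>)"
          using le[of \<omega>] by simp
      qed
    qed measurable
    have "expectation (\<lambda>\<omega>. (X j \<omega> + ?S \<omega>) ^ (2 * Suc p)) \<le> expectation U"
      by (rule integral_mono[OF int intU le])
    also have "expectation U = expectation (\<lambda>\<omega>. ?S \<omega> ^ (2 * Suc p))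
        + real (2 * Suc p) * expectation (\<lambda>\<omega>. X j \<omega> ^ 1 * ?S \<omega> ^ Suc ?n)
        + 2 ^ (2 * Suc p) * (expectation (\<lambda>\<omega>. X j \<omega> ^ 2 * ?S \<omega> ^ ?n)
          + expectation (\<lambda>\<omega>. X j \<omega> ^ (2 * Suc p)))"
    proof -
      have "integrable M (\<lambda>\<omega>. ?S \<omega> ^ (2 * Suc p))" "integrable M (\<lambda>\<omega>. X j \<omega> ^ 1 * ?S \<omega> ^ Suc ?n)"
        "integrable M (\<lambda>\<omega>. X j \<omega> ^ 2 * ?S \<omega> ^ ?n)" "integrable M (\<lambda>\<omega>. X j \<omega> ^ (2 * Suc p))"
        by (intro prod intX intS; simp)+
      then show ?thesis
        unfolding U_def
        by (simp only: Bochner_Integration.integral_add Bochner_Integration.integrable_add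
            integrable_mult_right integral_mult_right_zero)
    qed
    also have "expectation (\<lambda>\<omega>. X j \<omega> ^ 1 * ?S \<omega> ^ Suc ?n) = 0"
      using prod(2)[of 1 "Suc ?n"] insert.prems(5)[of j] by simp
    also have "expectation (\<lambda>\<omega>. ?S \<omega> ^ (2 * Suc p)) + real (2 * Suc p) * 0
        + 2 ^ (2 * Suc p) * (expectation (\<lambda>\<omega>. X j \<omega> ^ 2 * ?S \<omega> ^ ?n)
          + expectation (\<lambda>\<omega>. X j \<omega> ^ (2 * Suc p)))
      \<le> moment_const \<mu> (Suc p) * ?B ^ Suc p + real (2 * Suc p) * 0 + 2 ^ (2 * Suc p) *
          (\<mu> * moment_const \<mu> p * (v j * ?B ^ p) + \<mu> * v j ^ Suc p)"
    proof (intro add_mono mult_left_mono order.refl)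
      show "expectation (\<lambda>\<omega>. ?S \<omega> ^ (2 * Suc p)) \<le> moment_const \<mu> (Suc p) * ?B ^ Suc p"
        by (rule IHJ(2))
      have "expectation (\<lambda>\<omega>. X j \<omega> ^ 2 * ?S \<omega> ^ ?n) =
          expectation (\<lambda>\<omega>. X j \<omega> ^ 2) * expectation (\<lambda>\<omega>. ?S \<omega> ^ ?n)"
        by (rule prod) simp_all
      also have "\<dots> \<le> (\<mu> * v j) * (moment_const \<mu> p * ?B ^ p)"
      proof (rule mult_mono)
        show "expectation (\<lambda>\<omega>. X j \<omega> ^ 2) \<le> \<mu> * v j"
          using insert.prems(6)[of j 1] by simp
        show "0 \<le> expectation (\<lambda>\<omega>. ?S \<omega> ^ ?n)"
          by (intro integral_nonneg_AE AE_I2 zero_le_even_power) simp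
      qed (use IHp B0 \<open>0 < \<mu>\<close> in simp_all)
      finally show "expectation (\<lambda>\<omega>. X j \<omega> ^ 2 * ?S \<omega> ^ ?n) \<le>
          \<mu> * moment_const \<mu> p * (v j * ?B ^ p)"
        by (simp add: mult_ac)
      show "expectation (\<lambda>\<omega>. X j \<omega> ^ (2 * Suc p)) \<le> \<mu> * v j ^ Suc p"
        by (rule insert.prems(6)) simp_all
    qed simp_all
    also have "\<dots> \<le> moment_const \<mu> (Suc p) * ?B ^ Suc p + real (2 * Suc p) * 0 + 2 ^ (2 * Suc p) *
        (\<mu> * moment_const \<mu> p * ((?B + v j) ^ Suc p - ?B ^ Suc p)
          + \<mu> * ((?B + v j) ^ Suc p - ?B ^ Suc p))"
    proof (intro add_mono mult_left_mono order.refl)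
      show "v j * ?B ^ p \<le> (?B + v j) ^ Suc p - ?B ^ Suc p"
        "v j ^ Suc p \<le> (?B + v j) ^ Suc p - ?B ^ Suc p"
        using add_power_ge[OF B0, of p] by simp_all
    qed (use \<open>0 < \<mu>\<close> moment_const_pos[OF \<open>0 < \<mu>\<close>, of p] in simp_all)
    \<comment> \<open>The coefficient of the increment is exactly
      \<open>moment_const \<mu> (Suc p)\<close>, so the contribution of \<open>?B ^ Suc p\<close>
      cancels.\<close>
    also have "\<dots> = moment_const \<mu> (Suc p) * (?B + v j) ^ Suc p"
      by (simp only: moment_const.simps) (simp only: algebra_simps)
    finally show ?case
      using int unfolding eq eqB by blast
  qed
qed

section \<open>Scaled cells and Cauchy-Schwarz on a cell\<close>

abbreviation scaled_cell :: "nat \<Rightarrow> nat ^ 'd::finite \<Rightarrow> (real ^ 'd) set" where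
  "scaled_cell n k \<equiv> {u. real n *\<^sub>R u \<in> unit_cell k}"

text \<open>Each coordinate of the index is the floor of the corresponding coordinate of
  \<open>x\<close>, plus one.\<close>

lemma unit_cell_inject:
  assumes "x \<in> unit_cell k" "x \<in> unit_cell l"
  shows "k = l"
proof (subst vec_eq_iff, rule allI)
  fix i
  have "real (k $ i) - 1 \<le> x $ i" "x $ i < real (k $ i)"
    "real (l $ i) - 1 \<le> x $ i" "x $ i < real (l $ i)"
    using assms by (auto simp: unit_cell_def)
  then show "k $ i = l $ i" by linarith
qed

lemma finite_bounded_vec: "finite {k :: nat ^ 'd::finite. \<forall>i. 1 \<le> k $ i \<and> k $ i \<le> N}"
proof (rule finite_subset)
  show "{k :: nat ^ 'd. \<forall>i. 1 \<le> k $ i \<and> k $ i \<le> N} \<subseteq> vec_lambda ` (PiE UNIV (\<lambda>_. {..N}))"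
  proof
    fix k :: "nat ^ 'd" assume "k \<in> {k. \<forall>i. 1 \<le> k $ i \<and> k $ i \<le> N}"
    then show "k \<in> vec_lambda ` (PiE UNIV (\<lambda>_. {..N}))"
      by (intro image_eqI[of _ _ "vec_nth k"]) auto
  qed
qed (auto intro!: finite_imageI finite_PiE)

lemma scaled_cell_borel [measurable]: "scaled_cell n (k :: nat ^ 'd::finite) \<in> sets borel"
proof -
  have "scaled_cell n k =
    (\<Inter>i. {u. real (k $ i) - 1 \<le> real n * u $ i} \<inter> {u. real n * u $ i < real (k $ i)})"
    by (auto simp: unit_cell_def)
  also have "\<dots> \<in> sets borel"
    by (intro sets.finite_INT sets.Int borel_closed borel_open closed_Collect_le open_Collect_less
        continuous_intros) auto
  finally show ?thesis .
qed

lemma indicator_scaled_cell_measurable: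
  "indicat_real (scaled_cell n k) \<in> borel_measurable (lebesgue_on S)"
  using scaled_cell_borel[of n k]
  by (intro measurable_restrict_space1 borel_measurable_indicator) (auto intro: sets_completionI_sets)

text \<open>The cell lies in a closed box of side \<open>1 / n\<close>. An upper bound suffices,
  since cells meeting the boundary of \<open>S\<close> are cut off.\<close>

lemma measure_scaled_cell_le:
  fixes k :: "nat ^ 'd::finite"
  assumes "1 \<le> n" "S \<in> sets lebesgue"
  shows "measure (lebesgue_on S) (scaled_cell n k \<inter> S) \<le> 1 / real n ^ CARD('d)"
proof -
  let ?a = "\<chi> i. (real (k $ i) - 1) / n" and ?b = "\<chi> i. real (k $ i) / n"
  have A: "scaled_cell n k \<inter> S \<in> sets lebesgue"
    using scaled_cell_borel[of n k] assms(2) by (intro sets.Int) (auto intro: sets_completionI_sets)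
  have sub: "scaled_cell n k \<inter> S \<subseteq> cbox ?a ?b"
    using assms by (auto simp: unit_cell_def mem_box_cart field_simps) (meson less_imp_le)
  have "measure (lebesgue_on S) (scaled_cell n k \<inter> S) = measure lebesgue (scaled_cell n k \<inter> S)"
    using assms by (intro measure_restrict_space) auto
  also have "\<dots> \<le> measure lebesgue (cbox ?a ?b)"
    by (rule measure_mono_fmeasurable[OF sub A]) simp
  also have "\<dots> = (\<Prod>i\<in>(UNIV :: 'd set). ?b $ i - ?a $ i)"
  proof -
    have "cbox ?a ?b \<noteq> {}"
      by (auto simp: interval_eq_empty_cart not_less divide_right_mono)
    then show ?thesis
      by (simp add: content_cbox_cart)
  qed
  also have "\<dots> = 1 / real n ^ CARD('d)"
    using assms by (simp add: power_one_over flip: diff_divide_distrib)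
  finally show ?thesis .
qed

lemma integrable_mult_indicator_measurable:
  fixes f :: "'a \<Rightarrow> real"
  assumes f: "integrable M f" and A: "indicat_real A \<in> borel_measurable M"
  shows "integrable M (\<lambda>u. f u * indicator A u)"
proof (rule Bochner_Integration.integrable_bound[OF f])
  show "(\<lambda>u. f u * indicator A u) \<in> borel_measurable M"
    by (rule borel_measurable_times[OF borel_measurable_integrable[OF f] A])
qed (auto simp: indicator_def)

text \<open>Cauchy-Schwarz on \<open>A\<close>, by expanding the nonnegative integral of the square
  of \<open>g - c * a\<close> over \<open>A\<close>, where \<open>a\<close> is the integral of
  \<open>g\<close> over \<open>A\<close>. When \<open>A\<close> has measure \<open>1 / c\<close>,
  the number \<open>c * a\<close> is the mean of \<open>g\<close> on \<open>A\<close>.\<close>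

lemma (in finite_measure) integral_indicator_square_le:
  fixes g :: "'a \<Rightarrow> real"
  assumes [measurable]: "g \<in> borel_measurable M" "indicat_real A \<in> borel_measurable M"
    and g2: "integrable M (\<lambda>u. (g u)\<^sup>2)"
    and c: "0 < c" "measure M (A \<inter> space M) \<le> 1 / c"
  shows "c * (LINT u|M. g u * indicator A u)\<^sup>2 \<le> (LINT u|M. (g u)\<^sup>2 * indicator A u)"
proof -
  define a where "a = (LINT u|M. g u * indicator A u)"
  have g: "integrable M g"
    using integrable_power_le[OF _ g2, of 1] by simp
  note int = integrable_mult_indicator_measurable[OF _ assms(2)]
  have "0 \<le> (LINT u|M. (g u - c * a)\<^sup>2 * indicator A u)"
    by (intro integral_nonneg_AE) auto
  also have "\<dots> = (LINT u|M. (g u)\<^sup>2 * indicator A u - 2 * c * a * (g u * indicator A u)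
      + (c * a)\<^sup>2 * (1 * indicator A u))"
    by (intro Bochner_Integration.integral_cong) (auto simp: power2_eq_square algebra_simps)
  also have "\<dots> = (LINT u|M. (g u)\<^sup>2 * indicator A u) - 2 * c * a * a
      + (c * a)\<^sup>2 * (LINT u|M. 1 * indicator A u)"
    using int[OF g] int[OF g2] int[of "\<lambda>_. 1"] by (simp add: a_def)
  also have "(LINT u|M. 1 * indicator A u) = measure M (A \<inter> space M)"
    by simp
  finally have "2 * c * a * a \<le> (LINT u|M. (g u)\<^sup>2 * indicator A u)
      + (c * a)\<^sup>2 * measure M (A \<inter> space M)"
    by simp
  moreover have "(c * a)\<^sup>2 * measure M (A \<inter> space M) \<le> (c * a)\<^sup>2 * (1 / c)"
    using c by (intro mult_left_mono) auto
  moreover have "(c * a)\<^sup>2 * (1 / c) = c * a * a"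
    using c by (simp add: power2_eq_square)
  ultimately have "c * a * a \<le> (LINT u|M. (g u)\<^sup>2 * indicator A u)"
    by linarith
  then show ?thesis
    by (simp add: a_def power2_eq_square mult.assoc)
qed

section \<open>Donsker integrals as finite weighted sums\<close>

text \<open>On the box all coordinates of \<open>n u\<close> are at most \<open>N\<close>, so a cell
  with an index entry above \<open>N + 1\<close> is never reached. The entry \<open>N + 1\<close>
  itself must stay: cells are open on the right, and a coordinate equal to \<open>N\<close> belongs
  to it.\<close>

lemma donsker_kernel_eq_sum:
  fixes T :: "real ^ 'd::finite"
  assumes "u \<in> cbox 0 T" and N: "\<And>i. real n * T $ i \<le> real N"
  shows "donsker_kernel Z n u \<omega> = real n powr (real CARD('d) / 2) *
    (\<Sum>k\<in>{k. \<forall>i. 1 \<le> k $ i \<and> k $ i \<le> N + 1}. Z k \<omega> * indicator (scaled_cell n k) u)"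
proof -
  let ?K = "{k :: nat ^ 'd. \<forall>i. 1 \<le> k $ i \<and> k $ i \<le> N + 1}"
  have "(\<Sum>\<^sub>\<infinity>k\<in>pos_multi. Z k \<omega> * indicator (unit_cell k) (real n *\<^sub>R u)) =
      (\<Sum>\<^sub>\<infinity>k\<in>?K. Z k \<omega> * indicator (scaled_cell n k) u)"
  proof (rule infsum_cong_neutral)
    fix k :: "nat ^ 'd" assume "k \<in> pos_multi - ?K"
    then obtain i where "N + 1 < k $ i"
      unfolding pos_multi_def using not_le by blast
    moreover have "real n * u $ i \<le> real n * T $ i"
      using assms(1) by (intro mult_left_mono) (auto simp: mem_box_cart)
    ultimately have "real n * u $ i < real (k $ i) - 1"
      using N[of i] by linarith
    then have "real n *\<^sub>R u \<notin> unit_cell k"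
      by (auto simp: unit_cell_def not_le)
    then show "Z k \<omega> * indicator (unit_cell k) (real n *\<^sub>R u) = 0"
      by simp
  qed (auto simp: pos_multi_def indicator_def)
  also have "\<dots> = (\<Sum>k\<in>?K. Z k \<omega> * indicator (scaled_cell n k) u)"
    by (rule infsum_finite[OF finite_bounded_vec])
  finally show ?thesis
    by (simp only: donsker_kernel_def)
qed

lemma sum_indicator_scaled_cell_le_1:
  assumes "finite K"
  shows "(\<Sum>k\<in>K. indicator (scaled_cell n k) u) \<le> (1 :: real)"
proof (cases "\<exists>k\<in>K. u \<in> scaled_cell n k")
  case True
  then obtain k where k: "k \<in> K" "u \<in> scaled_cell n k" by blast
  then have "(\<Sum>l\<in>K. indicator (scaled_cell n l) u) = (\<Sum>l\<in>K. if l = k then 1 else (0 :: real))"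
    by (intro sum.cong) (auto simp: indicator_def dest: unit_cell_inject)
  then show ?thesis
    using assms k by simp
next
  case False
  then show ?thesis by (simp add: indicator_def)
qed

text \<open>The finite index set depends only on \<open>N\<close>, not on the outcome, so the
  identity holds for every \<open>\<omega>\<close> rather than almost surely.\<close>

lemma donsker_integral_eq_sum:
  fixes g :: "real ^ 'd::finite \<Rightarrow> real"
  assumes g: "integrable (lebesgue_on (cbox 0 T)) g"
    and N: "\<And>i. real n * T $ i \<le> real N"
  defines "c \<equiv> real n powr (real CARD('d) / 2)"
    and "a \<equiv> \<lambda>k. LINT u|lebesgue_on (cbox 0 T). g u * indicator (scaled_cell n k) u"
  shows "integrable (lebesgue_on (cbox 0 T)) (\<lambda>u. g u * donsker_kernel Z n u \<omega>)"
    and "(LINT u|lebesgue_on (cbox 0 T). g u * donsker_kernel Z n u \<omega>) =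
      (\<Sum>k\<in>{k. \<forall>i. 1 \<le> k $ i \<and> k $ i \<le> N + 1}. (c * a k) * Z k \<omega>)"
proof -
  let ?W = "lebesgue_on (cbox 0 T)"
  let ?K = "{k :: nat ^ 'd. \<forall>i. 1 \<le> k $ i \<and> k $ i \<le> N + 1}"
  let ?h = "\<lambda>u. \<Sum>k\<in>?K. (c * Z k \<omega>) * (g u * indicator (scaled_cell n k) u)"
  have eq: "g u * donsker_kernel Z n u \<omega> = ?h u" if "u \<in> space ?W" for u
  proof -
    have "u \<in> cbox 0 T" using that by simp
    then show ?thesis
      by (simp add: donsker_kernel_eq_sum[OF _ N] c_def sum_distrib_left mult_ac)
  qed
  have int: "integrable ?W (\<lambda>u. g u * indicator (scaled_cell n k) u)" for k
    by (rule integrable_mult_indicator_measurable[OF g indicator_scaled_cell_measurable])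
  show "integrable ?W (\<lambda>u. g u * donsker_kernel Z n u \<omega>)"
    by (rule iffD2[OF Bochner_Integration.integrable_cong[OF refl eq]], assumption)
      (intro Bochner_Integration.integrable_sum integrable_mult_right int)
  have "(LINT u|?W. g u * donsker_kernel Z n u \<omega>) = (LINT u|?W. ?h u)"
    by (rule Bochner_Integration.integral_cong[OF refl eq])
  also have "\<dots> = (\<Sum>k\<in>?K. (LINT u|?W. (c * Z k \<omega>) * (g u * indicator (scaled_cell n k) u)))"
    by (intro Bochner_Integration.integral_sum integrable_mult_right int)
  also have "\<dots> = (\<Sum>k\<in>?K. (c * a k) * Z k \<omega>)"
    by (intro sum.cong) (auto simp: a_def)
  finally show "(LINT u|?W. g u * donsker_kernel Z n u \<omega>) = (\<Sum>k\<in>?K. (c * a k) * Z k \<omega>)" .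
qed

text \<open>This is Bessel's inequality for the normalized cell indicators, which are orthogonal
  with norm at most 1 in L2 of the box. It is proved cell by cell with Cauchy-Schwarz and then
  summed using disjointness.\<close>

lemma sum_cell_integral_square_le:
  fixes g :: "real ^ 'd::finite \<Rightarrow> real"
  assumes g: "square_integrable_on g (cbox 0 T)" and "1 \<le> n" "finite K"
  shows "(\<Sum>k\<in>K. (real n powr (real CARD('d) / 2) *
      (LINT u|lebesgue_on (cbox 0 T). g u * indicator (scaled_cell n k) u))\<^sup>2)
    \<le> (LINT u|lebesgue_on (cbox 0 T). (g u)\<^sup>2)"
proof -
  let ?W = "lebesgue_on (cbox 0 T)"
  interpret W: finite_measure ?W
    by (rule finite_measure_lebesgue_on) simp
  have gm: "g \<in> borel_measurable ?W" and g2: "integrable ?W (\<lambda>u. (g u)\<^sup>2)"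
    using g by (auto simp: square_integrable_on_def)
  \<comment> \<open>The squared normalization is the reciprocal of the cell volume, hence the
    constant \<open>c\<close> in the Cauchy-Schwarz bound.\<close>
  have c2: "(real n powr (real CARD('d) / 2))\<^sup>2 = real n ^ CARD('d)"
    using \<open>1 \<le> n\<close> by (simp add: power2_eq_square powr_realpow flip: powr_add)
  have int: "integrable ?W (\<lambda>u. (g u)\<^sup>2 * indicator (scaled_cell n k) u)" for k
    by (rule integrable_mult_indicator_measurable[OF g2 indicator_scaled_cell_measurable])
  have "(\<Sum>k\<in>K. (real n powr (real CARD('d) / 2) *
      (LINT u|?W. g u * indicator (scaled_cell n k) u))\<^sup>2)
    \<le> (\<Sum>k\<in>K. (LINT u|?W. (g u)\<^sup>2 * indicator (scaled_cell n k) u))"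
  proof (rule sum_mono)
    fix k
    have "real n ^ CARD('d) * (LINT u|?W. g u * indicator (scaled_cell n k) u)\<^sup>2
        \<le> (LINT u|?W. (g u)\<^sup>2 * indicator (scaled_cell n k) u)"
      using measure_scaled_cell_le[OF \<open>1 \<le> n\<close>, of "cbox 0 T" k] \<open>1 \<le> n\<close>
      by (intro W.integral_indicator_square_le gm g2 indicator_scaled_cell_measurable)
        simp_all
    then show "(real n powr (real CARD('d) / 2) *
        (LINT u|?W. g u * indicator (scaled_cell n k) u))\<^sup>2
        \<le> (LINT u|?W. (g u)\<^sup>2 * indicator (scaled_cell n k) u)"
      by (simp only: power_mult_distrib c2)
  qed
  also have "\<dots> = (LINT u|?W. (\<Sum>k\<in>K. (g u)\<^sup>2 * indicator (scaled_cell n k) u))"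
    by (rule Bochner_Integration.integral_sum[symmetric, OF int])
  also have "\<dots> \<le> (LINT u|?W. (g u)\<^sup>2)"
  proof (rule integral_mono[OF Bochner_Integration.integrable_sum[OF int] g2])
    fix u
    show "(\<Sum>k\<in>K. (g u)\<^sup>2 * indicator (scaled_cell n k) u) \<le> (g u)\<^sup>2"
      using mult_left_mono[OF sum_indicator_scaled_cell_le_1[OF \<open>finite K\<close>, of n u], of "(g u)\<^sup>2"]
      by (simp add: sum_distrib_left)
  qed
  finally show ?thesis .
qed

section \<open>The moment estimate for Donsker integrals\<close>

text \<open>Integrability is part of the conclusion because a Bochner integral that does not exist
  has the value 0, which would make the bare inequality uninformative. The witness for
  \<open>C\<close> depends only on \<open>m\<close> and the common absolute moment of order
  \<open>m\<close>.\<close>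

theorem proposition3p1:
  fixes M :: "'w measure"
    and Z :: "nat ^ 'd::finite \<Rightarrow> 'w \<Rightarrow> real"
    and T :: "real ^ 'd"
    and m :: nat
  assumes "prob_space M"
    and "\<And>i. 0 < T $ i"
    and "prob_space.indep_vars M (\<lambda>_. borel) Z pos_multi"
    and "\<And>k l. k \<in> pos_multi \<Longrightarrow> l \<in> pos_multi \<Longrightarrow> distr M borel (Z k) = distr M borel (Z l)"
    and "\<And>k. k \<in> pos_multi \<Longrightarrow> integrable M (Z k)"
    and "\<And>k. k \<in> pos_multi \<Longrightarrow> prob_space.expectation M (Z k) = 0"
    and "\<And>k. k \<in> pos_multi \<Longrightarrow> integrable M (\<lambda>\<omega>. (Z k \<omega>)\<^sup>2)"
    and "\<And>k. k \<in> pos_multi \<Longrightarrow> prob_space.variance M (Z k) = 1"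
    and "even m" and "1 \<le> m"
    and "\<And>k. k \<in> pos_multi \<Longrightarrow> integrable M (\<lambda>\<omega>. \<bar>Z k \<omega>\<bar> ^ m)"
  shows "\<exists>C>0. \<forall>g :: nat \<Rightarrow> real ^ 'd \<Rightarrow> real.
    (\<forall>n\<ge>1. square_integrable_on (g n) (cbox 0 T)) \<longrightarrow>
    (\<forall>n\<ge>1.
      (\<forall>\<omega>\<in>space M. integrable (lebesgue_on (cbox 0 T)) (\<lambda>u. g n u * donsker_kernel Z n u \<omega>)) \<and>
      integrable M (\<lambda>\<omega>. (LINT u|lebesgue_on (cbox 0 T). g n u * donsker_kernel Z n u \<omega>) ^ m) \<and>
      prob_space.expectation M
        (\<lambda>\<omega>. (LINT u|lebesgue_on (cbox 0 T). g n u * donsker_kernel Z n u \<omega>) ^ m)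
      \<le> C * (LINT u|lebesgue_on (cbox 0 T). (g n u)\<^sup>2) powr (real m / 2))"
proof -
  interpret prob_space M by fact
  note indep = assms(3) and ident = assms(4) and mean0 = assms(6) and moment = assms(11)
  obtain p where m: "m = 2 * p" using \<open>even m\<close> by blast
  with \<open>1 \<le> m\<close> have p: "0 < p" by simp
  define k0 :: "nat ^ 'd" where "k0 = (\<chi> i. 1)"
  \<comment> \<open>Since \<open>1 + \<bar>z\<bar> ^ m\<close> dominates all lower powers, this one
    number bounds every even moment up to order \<open>m\<close>, for every index by equality of
    laws. The added 1 also makes it positive.\<close>
  define \<mu> where "\<mu> = 1 + expectation (\<lambda>\<omega>. \<bar>Z k0 \<omega>\<bar> ^ m)"
  have k0: "k0 \<in> pos_multi" by (simp add: k0_def pos_multi_def)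
  have \<mu>: "0 < \<mu>"
    unfolding \<mu>_def by (intro add_pos_nonneg integral_nonneg_AE) auto
  have rv [measurable]: "random_variable borel (Z k)" if "k \<in> pos_multi" for k
    using indep that by (simp add: indep_vars_def)
  have Zm: "expectation (\<lambda>\<omega>. \<bar>Z k \<omega>\<bar> ^ m) = expectation (\<lambda>\<omega>. \<bar>Z k0 \<omega>\<bar> ^ m)"
    if k: "k \<in> pos_multi" for k
  proof -
    have "expectation (\<lambda>\<omega>. \<bar>Z j \<omega>\<bar> ^ m) = (LINT x|distr M borel (Z j). \<bar>x\<bar> ^ m)"
      if "j \<in> pos_multi" for j
      using rv[OF that] by (simp add: integral_distr)
    then show ?thesis
      using ident[OF k k0] k k0 by simp
  qed
  have intZ: "integrable M (\<lambda>\<omega>. Z k \<omega> ^ (2 * q))" if "k \<in> pos_multi" "q \<le> p" for k q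
    by (rule integrable_power_le[OF rv, of _ m])
      (use moment[OF that(1)] that \<open>even m\<close> m in \<open>simp_all add: power_even_abs\<close>)
  have EZ: "expectation (\<lambda>\<omega>. Z k \<omega> ^ (2 * q)) \<le> \<mu>" if k: "k \<in> pos_multi" and q: "q \<le> p" for k q
  proof -
    have "expectation (\<lambda>\<omega>. Z k \<omega> ^ (2 * q)) \<le> expectation (\<lambda>\<omega>. 1 + \<bar>Z k \<omega>\<bar> ^ m)"
    proof (rule integral_mono)
      show "Z k \<omega> ^ (2 * q) \<le> 1 + \<bar>Z k \<omega>\<bar> ^ m" for \<omega>
        using abs_power_le_1_plus_power[of "2 * q" m "Z k \<omega>"] q m
        by (simp add: power_even_abs)
    qed (use intZ[OF k q] moment[OF k] in simp_all)
    also have "\<dots> = \<mu>"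
      using moment[OF k] Zm[OF k] by (simp add: \<mu>_def prob_space)
    finally show ?thesis .
  qed
  show ?thesis
  proof (intro exI[of _ "moment_const \<mu> p"] conjI allI impI)
    show "0 < moment_const \<mu> p" by (rule moment_const_pos[OF \<mu>])
    fix g :: "nat \<Rightarrow> real ^ 'd \<Rightarrow> real" and n :: nat
    assume "\<forall>n\<ge>1. square_integrable_on (g n) (cbox 0 T)" and n: "1 \<le> n"
    then have g: "square_integrable_on (g n) (cbox 0 T)" by blast
    let ?W = "lebesgue_on (cbox 0 T)"
    let ?I = "\<lambda>\<omega>. LINT u|?W. g n u * donsker_kernel Z n u \<omega>"
    interpret W: finite_measure ?W
      by (rule finite_measure_lebesgue_on) simp
    \<comment> \<open>The box has finite measure, so square integrability gives
      integrability.\<close>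
    have gi: "integrable ?W (g n)"
      using g W.integrable_power_le[of "g n" 2 1] by (simp add: square_integrable_on_def)
    define N where "N = nat \<lceil>Max (range (\<lambda>i. real n * T $ i))\<rceil>"
    have N: "real n * T $ i \<le> real N" for i
      unfolding N_def by (rule order_trans[OF Max_ge real_nat_ceiling_ge]) auto
    define K where "K = {k :: nat ^ 'd. \<forall>i. 1 \<le> k $ i \<and> k $ i \<le> N + 1}"
    have K: "finite K" "K \<subseteq> pos_multi"
      unfolding K_def by (rule finite_bounded_vec) (auto simp: pos_multi_def)
    define b where "b = (\<lambda>k. real n powr (real CARD('d) / 2) *
      (LINT u|?W. g n u * indicator (scaled_cell n k) u))"
    have I_eq: "?I \<omega> = (\<Sum>k\<in>K. b k * Z k \<omega>)" for \<omega>
      unfolding b_def K_def by (rule donsker_integral_eq_sum(2)[OF gi N])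
    have "indep_vars (\<lambda>_. borel) (\<lambda>k \<omega>. b k * Z k \<omega>) K"
      by (rule indep_vars_compose2[OF indep_vars_subset[OF indep K(2)]]) simp
    \<comment> \<open>The general moment bound is used with summands \<open>b k * Z k\<close> and
      variance scales \<open>(b k)\<^sup>2\<close>.\<close>
    then have main: "integrable M (\<lambda>\<omega>. (\<Sum>k\<in>K. b k * Z k \<omega>) ^ (2 * p)) \<and>
      expectation (\<lambda>\<omega>. (\<Sum>k\<in>K. b k * Z k \<omega>) ^ (2 * p)) \<le>
        moment_const \<mu> p * (\<Sum>k\<in>K. (b k)\<^sup>2) ^ p"
    proof (rule even_moment_sum_indep_le[OF K(1) _ \<mu>])
      fix k assume "k \<in> K"
      then have k: "k \<in> pos_multi" using K by auto
      show "integrable M (\<lambda>\<omega>. (b k * Z k \<omega>) ^ (2 * p))"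
        using intZ[OF k, of p] by (simp add: power_mult_distrib)
      show "expectation (\<lambda>\<omega>. b k * Z k \<omega>) = 0"
        using mean0[OF k] by simp
      fix q assume q: "q \<le> p"
      have "(b k)\<^sup>2 ^ q * expectation (\<lambda>\<omega>. Z k \<omega> ^ (2 * q)) \<le> (b k)\<^sup>2 ^ q * \<mu>"
        by (intro mult_left_mono EZ[OF k q]) simp
      then show "expectation (\<lambda>\<omega>. (b k * Z k \<omega>) ^ (2 * q)) \<le> \<mu> * (b k)\<^sup>2 ^ q"
        by (simp add: power_mult_distrib mult.commute flip: power_mult)
    qed simp
    show "integrable M (\<lambda>\<omega>. ?I \<omega> ^ m)"
      using main by (simp add: I_eq m)
    show "\<forall>\<omega>\<in>space M. integrable ?W (\<lambda>u. g n u * donsker_kernel Z n u \<omega>)"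
      by (intro ballI donsker_integral_eq_sum(1)[OF gi N])
    let ?G = "LINT u|?W. (g n u)\<^sup>2"
    have "expectation (\<lambda>\<omega>. ?I \<omega> ^ m) \<le> moment_const \<mu> p * (\<Sum>k\<in>K. (b k)\<^sup>2) ^ p"
      using main by (simp add: I_eq m)
    also have "\<dots> \<le> moment_const \<mu> p * ?G ^ p"
    proof (intro mult_left_mono power_mono)
      show "(\<Sum>k\<in>K. (b k)\<^sup>2) \<le> ?G"
        unfolding b_def by (rule sum_cell_integral_square_le[OF g n K(1)])
    qed (use moment_const_pos[OF \<mu>, of p] in \<open>auto intro: sum_nonneg\<close>)
    also have "?G ^ p = ?G powr (real m / 2)"
    proof -
      have "0 \<le> ?G" by (intro integral_nonneg_AE) auto
      \<comment> \<open>Positivity of \<open>p\<close> matters when \<open>?G\<close> vanishes: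
        \<open>0 powr 0\<close> is 0, whereas \<open>0 ^ 0\<close> is 1.\<close>
      from powr_realpow'[OF this, of p] show ?thesis using p by (simp add: m)
    qed
    finally show "expectation (\<lambda>\<omega>. ?I \<omega> ^ m) \<le> moment_const \<mu> p * ?G powr (real m / 2)" .
  qed
qed

end
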